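(* Let $a\in\mathbb{R}$ and $b\ge-1$. The function $g_1(z)=\frac{a}{2}+\frac1z$ is the unique analytic function $g$ on a punctured neighbourhood of $0$ in $\mathbb{C}$ satisfying $$-[bz^2+az+1]\,g'(z)=g(z)^2+b-\frac{a^2}{4}$$ and $\lim_{z\to0}zg(z)=1$. (Uniqueness is understood as follows: $g_1$ satisfies these conditions, and any analytic function $g$ on a punctured disc centred at $0$ satisfying them equals $\frac a2+\frac1z$ there.) *)

theory Defs
  imports "HOL-Complex_Analysis.Complex_Analysis"
begin

definition punctured_disc :: "real \<Rightarrow> complex set" where
  "punctured_disc r = ball 0 r - {0}"

definition riccati_solution :: "real \<Rightarrow> real \<Rightarrow> real \<Rightarrow> (complex \<Rightarrow> complex) \<Rightarrow> bool" where
  "riccati_solution a b r g \<longleftrightarrow>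
     g analytic_on punctured_disc r \<and>
     (\<forall>z\<in>punctured_disc r.
        - (of_real b * z\<^sup>2 + of_real a * z + 1) * deriv g z = (g z)\<^sup>2 + of_real b - (of_real a)\<^sup>2 / 4) \<and>
     ((\<lambda>z. z * g z) \<longlongrightarrow> 1) (at 0)"

definition g1 :: "real \<Rightarrow> complex \<Rightarrow> complex" where
  "g1 a z = of_real a / 2 + 1 / z"

end

theory Submission
  imports Defs
begin

text \<open>The difference \<open>u = g - g1\<close> satisfies \<open>z u(z) \<rightarrow> 0\<close>, so it extends holomorphically over \<open>0\<close>,
  and the Riccati equations give \<open>- z (b z^2 + a z + 1) u' = u (z u + a z + 2)\<close>. If \<open>u\<close> vanished
  to finite order \<open>n \<ge> 0\<close> at \<open>0\<close>, comparing lowest-order coefficients would give \<open>- n = 2\<close>.\<close>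

lemma open_punctured_disc: "open (punctured_disc r)"
  unfolding punctured_disc_def by (simp add: open_delete)

lemma g1_has_field_derivative:
  assumes "z \<noteq> 0"
  shows "(g1 a has_field_derivative - 1 / z\<^sup>2) (at z)"
proof -
  have "((\<lambda>z. of_real a / 2 + 1 / z) has_field_derivative - 1 / z\<^sup>2) (at z)"
    using assms by (auto intro!: derivative_eq_intros simp: power2_eq_square)
  then show ?thesis
    by (simp add: g1_def[abs_def])
qed

text \<open>With derivative \<open>- 1 / z\<^sup>2\<close>, both sides of the equation reduce to
  \<open>b + a / z + 1 / z\<^sup>2\<close>.\<close>

lemma riccati_solution_g1: "riccati_solution a b r (g1 a)"
  unfolding riccati_solution_def
proof (intro conjI ballI)
  have "g1 a holomorphic_on punctured_disc r"
    unfolding g1_def punctured_disc_def by (intro holomorphic_intros) auto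
  then show "g1 a analytic_on punctured_disc r"
    using analytic_on_open open_punctured_disc by blast
next
  fix z assume "z \<in> punctured_disc r"
  then have "z \<noteq> 0"
    by (auto simp: punctured_disc_def)
  then have "deriv (g1 a) z = - 1 / z\<^sup>2"
    by (intro DERIV_imp_deriv g1_has_field_derivative)
  then show "- (of_real b * z\<^sup>2 + of_real a * z + 1) * deriv (g1 a) z
      = (g1 a z)\<^sup>2 + of_real b - (of_real a)\<^sup>2 / 4"
    using \<open>z \<noteq> 0\<close> by (simp only: g1_def) (simp add: field_simps power2_eq_square)
next
  have "((\<lambda>z. z * (of_real a / 2) + 1) \<longlongrightarrow> 0 * (of_real a / 2) + 1) (at (0::complex))"
    by (intro tendsto_intros)
  moreover have "\<forall>\<^sub>F z in at 0. z * g1 a z = z * (of_real a / 2) + 1"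
    unfolding eventually_at by (intro exI[of _ 1]) (auto simp: g1_def distrib_left)
  ultimately show "((\<lambda>z. z * g1 a z) \<longlongrightarrow> 1) (at 0)"
    by (simp add: tendsto_cong)
qed

text \<open>The values of \<open>P\<close> and \<open>Q\<close> at 0 make -2 the only possible
  exponent there, while a holomorphic \<open>U\<close> has order at least 0. Only continuity is
  asked of the coefficients, and \<open>Q\<close> may be built from \<open>U\<close> itself, which
  lets a nonlinear equation be treated as linear.\<close>

lemma singular_linear_ode_zero:
  fixes U P Q :: "complex \<Rightarrow> complex"
  assumes "r > 0" and U: "U holomorphic_on ball 0 r"
    and P: "continuous_on (ball 0 r) P" "P 0 = 1"
    and Q: "continuous_on (ball 0 r) Q" "Q 0 = 2"
    and ode: "\<And>z. z \<in> ball 0 r \<Longrightarrow> z \<noteq> 0 \<Longrightarrow> - (z * P z * deriv U z) = U z * Q z"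
    and "z \<in> ball 0 r"
  shows "U z = 0"
proof -
  \<comment> \<open>The equation is known only off 0; continuity of both sides carries it to the
    centre, where it can be evaluated.\<close>
  have limit_eq: "f 0 = h 0"
    if "s > 0" "continuous_on (ball 0 s) f" "continuous_on (ball 0 s) h"
      "\<And>w. w \<in> ball 0 s \<Longrightarrow> w \<noteq> 0 \<Longrightarrow> f w = h w" for s and f h :: "complex \<Rightarrow> complex"
  proof (rule tendsto_unique)
    show "(f \<longlongrightarrow> f 0) (at 0)"
      using that(1,2) continuous_on_interior[of "ball 0 s" f 0] by (simp add: isCont_def)
    have "(h \<longlongrightarrow> h 0) (at 0)"
      using that(1,3) continuous_on_interior[of "ball 0 s" h 0] by (simp add: isCont_def)
    moreover have "\<forall>\<^sub>F w in at 0. f w = h w"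
      unfolding eventually_at using that(1,4) by (intro exI[of _ s]) (auto simp: dist_commute)
    ultimately show "(f \<longlongrightarrow> h 0) (at 0)"
      by (simp add: tendsto_cong)
  qed simp
  have U_cont: "continuous_on (ball 0 r) U"
    using U by (rule holomorphic_on_imp_continuous_on)
  have dU_cont: "continuous_on (ball 0 r) (deriv U)"
    using U by (intro holomorphic_on_imp_continuous_on holomorphic_deriv) auto
  \<comment> \<open>Order 0 is excluded first: at the centre the equation reads
    \<open>0 = 2 * U 0\<close>.\<close>
  have "- (0 * P 0 * deriv U 0) = U 0 * Q 0"
    by (rule limit_eq[OF \<open>r > 0\<close>, where f = "\<lambda>z. - (z * P z * deriv U z)"])
      (auto intro!: continuous_intros P Q U_cont dU_cont ode)
  with Q have "U 0 = 0"
    by simp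
  show ?thesis
  \<comment> \<open>A constant \<open>U\<close> equals \<open>U 0 = 0\<close>. A nonconstant one has
    a zero of finite order at 0, since the ball is connected; this case ends in a
    contradiction.\<close>
  proof (cases "U constant_on ball 0 r")
    case True
    with \<open>U 0 = 0\<close> \<open>r > 0\<close> \<open>z \<in> ball 0 r\<close> show ?thesis
      by (metis constant_on_def centre_in_ball)
  next
    case False
    have "0 \<in> ball (0::complex) r"
      using \<open>r > 0\<close> by simp
    then obtain V s n where "n > 0" "s > 0" and sub: "ball (0::complex) s \<subseteq> ball 0 r"
      and V: "V holomorphic_on ball 0 s"
      and U_eq: "\<And>w. w \<in> ball 0 s \<Longrightarrow> U w = (w - 0) ^ n * V w"
      and V_nz: "\<And>w. w \<in> ball 0 s \<Longrightarrow> V w \<noteq> 0"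
      by (rule holomorphic_factor_zero_nonconstant
        [OF U open_ball connected_ball _ \<open>U 0 = 0\<close> False]) (rule that)
    have dV_cont: "continuous_on (ball 0 s) (deriv V)"
      using V by (intro holomorphic_on_imp_continuous_on holomorphic_deriv) auto
    have PQ_cont: "continuous_on (ball 0 s) P" "continuous_on (ball 0 s) Q"
      using continuous_on_subset[OF P(1) sub] continuous_on_subset[OF Q(1) sub] .
    \<comment> \<open>This is the equation for \<open>U = w ^ n * V\<close> divided by
      \<open>w ^ n\<close>; the factor \<open>w\<close> in front of \<open>deriv U\<close> raises
      \<open>w ^ (n - 1)\<close> to \<open>w ^ n\<close>.\<close>
    have V_eq: "- (P w * (of_nat n * V w + w * deriv V w)) = V w * Q w"
      if "w \<in> ball 0 s" "w \<noteq> 0" for w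
    proof -
      have "((\<lambda>w. w ^ n * V w) has_field_derivative
          of_nat n * w ^ (n - 1) * V w + w ^ n * deriv V w) (at w)"
        using holomorphic_derivI[OF V open_ball that(1)]
        by (auto intro!: derivative_eq_intros)
      then have "(U has_field_derivative
          of_nat n * w ^ (n - 1) * V w + w ^ n * deriv V w) (at w)"
        by (rule has_field_derivative_transform_within_open[OF _ open_ball that(1)])
          (simp add: U_eq)
      then have "deriv U w = of_nat n * w ^ (n - 1) * V w + w ^ n * deriv V w"
        by (rule DERIV_imp_deriv)
      moreover have "w * w ^ (n - 1) = w ^ n"
        using \<open>n > 0\<close> by (metis power_minus_mult mult.commute)
      ultimately have "w * deriv U w = w ^ n * (of_nat n * V w + w * deriv V w)"
        by (simp add: algebra_simps)
      moreover have "- (P w * (w * deriv U w)) = U w * Q w"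
        using ode[of w] that sub by (auto simp: mult_ac)
      ultimately have "w ^ n * (- (P w * (of_nat n * V w + w * deriv V w))) = w ^ n * (V w * Q w)"
        using U_eq[OF that(1)] by (simp add: mult_ac)
      then show ?thesis
        using that(2) by (metis mult_left_cancel power_not_zero)
    qed
    \<comment> \<open>At 0 this says \<open>- n * V 0 = 2 * V 0\<close>, impossible since
      \<open>V 0\<close> is nonzero and \<open>n + 2\<close> is positive.\<close>
    have "- (P 0 * (of_nat n * V 0 + 0 * deriv V 0)) = V 0 * Q 0"
      by (rule limit_eq[OF \<open>s > 0\<close>, where f = "\<lambda>w. - (P w * (of_nat n * V w + w * deriv V w))"])
        (auto intro!: continuous_intros PQ_cont dV_cont holomorphic_on_imp_continuous_on[OF V] V_eq)
    then have "V 0 * of_nat (n + 2) = 0"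
      using P Q by (simp add: algebra_simps add_eq_0_iff)
    with V_nz[of 0] \<open>s > 0\<close> show ?thesis
      by (metis centre_in_ball mult_eq_0_iff of_nat_eq_0_iff add_2_eq_Suc' nat.distinct(1))
  qed
qed

lemma riccati_solution_eq_g1:
  assumes "r > 0" and g: "riccati_solution a b r g" and z: "z \<in> punctured_disc r"
  shows "g z = g1 a z"
proof -
  define u where "u w = g w - g1 a w" for w
  have hol: "f holomorphic_on ball 0 r - {0}" if "riccati_solution a b r f" for f
    using that unfolding riccati_solution_def punctured_disc_def
    by (blast intro: analytic_imp_holomorphic)
  have u: "u holomorphic_on ball 0 r - {0}"
    unfolding u_def by (intro holomorphic_intros hol g riccati_solution_g1)
  have "((\<lambda>w. w * g w - w * g1 a w) \<longlongrightarrow> 1 - 1) (at 0)"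
    using g riccati_solution_g1[of a b r]
    by (intro tendsto_diff) (auto simp: riccati_solution_def)
  then have "((\<lambda>w. (w - 0) * u w) \<longlongrightarrow> 0) (at 0)"
    by (simp add: u_def right_diff_distrib)
  \<comment> \<open>The poles of \<open>g\<close> and \<open>g1 a\<close> have the same residue 1,
    so \<open>w * u w\<close> tends to 0 and the singularity of \<open>u\<close> is
    removable.\<close>
  then obtain U where U: "U holomorphic_on ball 0 r"
    and U_eq: "\<And>w. w \<in> ball 0 r - {0} \<Longrightarrow> U w = u w"
    using holomorphic_on_extend_lim[OF u] \<open>r > 0\<close> by auto
  define P where "P w = of_real b * w\<^sup>2 + of_real a * w + 1" for w :: complex
  \<comment> \<open>\<open>Q w\<close> is \<open>w * (U w + 2 * g1 a w)\<close> with the pole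
    cancelled. Keeping \<open>U\<close> inside the coefficient hides the quadratic term, and the
    pole of \<open>g1 a\<close> supplies the value 2 at 0.\<close>
  define Q where "Q w = w * U w + of_real a * w + 2" for w
  have "U z = 0"
  proof (rule singular_linear_ode_zero[OF \<open>r > 0\<close> U, of P Q])
    show "continuous_on (ball 0 r) P"
      unfolding P_def by (intro continuous_intros)
    show "continuous_on (ball 0 r) Q"
      unfolding Q_def by (intro continuous_intros holomorphic_on_imp_continuous_on[OF U])
    show "P 0 = 1" "Q 0 = 2"
      by (simp_all add: P_def Q_def)
    show "z \<in> ball 0 r"
      using z by (simp add: punctured_disc_def)
  next
    fix w :: complex assume "w \<in> ball 0 r" and "w \<noteq> 0"
    then have w: "w \<in> punctured_disc r" "w \<in> ball 0 r - {0}"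
      by (auto simp: punctured_disc_def)
    have open': "open (ball 0 r - {0::complex})"
      by (simp add: open_delete)
    have "(u has_field_derivative deriv g w - deriv (g1 a) w) (at w)"
      unfolding u_def
      by (intro DERIV_diff holomorphic_derivI[OF _ open' w(2)] hol g riccati_solution_g1)
    then have "(U has_field_derivative deriv g w - deriv (g1 a) w) (at w)"
      by (rule has_field_derivative_transform_within_open[OF _ open' w(2)]) (simp add: U_eq)
    then have "deriv U w = deriv g w - deriv (g1 a) w"
      by (rule DERIV_imp_deriv)
    moreover have "- P w * deriv f w = (f w)\<^sup>2 + of_real b - (of_real a)\<^sup>2 / 4"
      if "riccati_solution a b r f" for f
      using that w(1) unfolding riccati_solution_def P_def by blast
    \<comment> \<open>Subtracting the two Riccati equations removes the constant term
      \<open>b - a\<^sup>2 / 4\<close>, leaving a difference of squares divisible by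
      \<open>U w\<close>.\<close>
    from this[OF g] this[OF riccati_solution_g1]
    have "- P w * deriv g w - - P w * deriv (g1 a) w = (g w)\<^sup>2 - (g1 a w)\<^sup>2"
      by simp
    ultimately have "- P w * deriv U w = (g w)\<^sup>2 - (g1 a w)\<^sup>2"
      by (simp only: right_diff_distrib)
    also have "\<dots> = U w * (U w + 2 * g1 a w)"
      unfolding U_eq[OF w(2)] u_def by (simp add: algebra_simps power2_eq_square)
    finally have "w * (- P w * deriv U w) = U w * (w * (U w + 2 * g1 a w))"
      by (simp add: mult_ac)
    also have "w * (U w + 2 * g1 a w) = Q w"
      using \<open>w \<noteq> 0\<close> by (simp add: Q_def g1_def field_simps)
    finally show "- (w * P w * deriv U w) = U w * Q w"
      by (simp add: mult_ac)
  qed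
  then show ?thesis
    using U_eq[of z] z by (simp add: u_def punctured_disc_def)
qed

theorem mainTheorem5:
  fixes a b :: real
  assumes "b \<ge> -1"
  shows "(\<forall>r>0. riccati_solution a b r (g1 a)) \<and>
         (\<forall>r>0. \<forall>g. riccati_solution a b r g \<longrightarrow> (\<forall>z\<in>punctured_disc r. g z = g1 a z))"
  using riccati_solution_g1 riccati_solution_eq_g1 by blast

end
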